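(* Let $(Q,\cdot)$ be a quasigroup. For $j\in\{1,2,3\}$ put $v(1)=r$, $v(2)=l$, $v(3)=m$. Then for all $\sigma,\tau\in S_3$ the following hold. (1) With $v=v(\tau^{-1}2)$, if ${}^{\sigma}N_v^A\neq\emptyset$ and ${}^{\tau}N_l^A\neq\emptyset$, then ${}^{\sigma}N_v^A\;{}^{\tau}N_l^A={}^{\sigma\tau}N_l^A$; further, ${}^{\sigma}_{\tau^{-1}1}N_v^A\;{}^{\tau}_{1}N_l^A={}^{\sigma\tau}_{1}N_l^A$ and ${}^{\sigma}_{\tau^{-1}3}N_v^A\;{}^{\tau}_{3}N_l^A={}^{\sigma\tau}_{3}N_l^A$. (2) With $v=v(\tau^{-1}1)$, if ${}^{\sigma}N_v^A\neq\emptyset$ and ${}^{\tau}N_r^A\neq\emptyset$, then ${}^{\sigma}N_v^A\;{}^{\tau}N_r^A={}^{\sigma\tau}N_r^A$; further, ${}^{\sigma}_{\tau^{-1}2}N_v^A\;{}^{\tau}_{2}N_r^A={}^{\sigma\tau}_{2}N_r^A$ and ${}^{\sigma}_{\tau^{-1}3}N_v^A\;{}^{\tau}_{3}N_r^A={}^{\sigma\tau}_{3}N_r^A$. (3) With $v=v(\tau^{-1}3)$, if ${}^{\sigma}N_v^A\neq\emptyset$ and ${}^{\tau}N_m^A\neq\emptyset$, then ${}^{\sigma}N_v^A\;{}^{\tau}N_m^A={}^{\sigma\tau}N_m^A$; further, ${}^{\sigma}_{\tau^{-1}1}N_v^A\;{}^{\tau}_{1}N_m^A={}^{\sigma\tau}_{1}N_m^A$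 and ${}^{\sigma}_{\tau^{-1}2}N_v^A\;{}^{\tau}_{2}N_m^A={}^{\sigma\tau}_{2}N_m^A$.
   Context: A quasigroup $(Q,A)$ is a set $Q$ with a binary operation $A$ such that for all $a,b\in Q$ the equations $A(x,a)=b$ and $A(a,y)=b$ have unique solutions $x,y\in Q$. (In the claim, $A$ as an operation is written $\cdot$.) Conventions. Products in $S_3$ are computed from left to right, i.e. $(\sigma\tau)i=\tau(\sigma i)$, and $\sigma i$ is the image of $i$ under $\sigma$; $\varepsilon$ denotes an identity permutation (of $Q$ or in $S_3$). Permutations of $Q$ are composed as functions, $(\alpha\beta)(x)=\alpha(\beta(x))$. Triples of permutations of $Q$ are multiplied and inverted componentwise. For a triple $R=(\alpha_1,\alpha_2,\alpha_3)$ and $\tau\in S_3$, $R^{\tau}=(\alpha_{\tau^{-1}1},\alpha_{\tau^{-1}2},\alpha_{\tau^{-1}3})$. For $\sigma\in S_3$ the $\sigma$-parastrophe $A^\sigma$ of a quasigroup operation $A$ is the quasigroup operation determined by: $A(x_1,x_2)=x_3$ if and only if $A^{\sigma}(x_{\sigma^{-1}1},x_{\sigma^{-1}2})=x_{\sigma^{-1}3}$. For $\sigma\in S_3$ and a triple $R=(\alpha_1,\alpha_2,\alpha_3)$ of permutations of $Q$, the isostrophic image $A(\sigma,R)=(A^\sigma)R$ is the operation $B(x_1,x_2)=\alpha_3^{-1}\bigl(A^\sigma(\alpha_1x_1,\alpha_2x_2)\bigr)$. Pairs $(\sigma,R)$ are multiplied by $(\sigma,R)(\tau,S)=(\sigma\tau,R^{\tau}S)$,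 with inverses $(\sigma,R)^{-1}=(\sigma^{-1},(R^{-1})^{\sigma^{-1}})$. An autostrophism of $(Q,A)$ is a pair $(\sigma,R)$ with $A(\sigma,R)=A$; the set $Aus(Q,A)$ of all of them is a group under this multiplication. For $\sigma\in S_3$, the left (respectively right, middle) $\sigma$-A-nucleus ${}^{\sigma}N_l^A$ (respectively ${}^{\sigma}N_r^A$, ${}^{\sigma}N_m^A$) of a quasigroup is the set of all its autostrophisms of the form $(\sigma,(\alpha,\varepsilon,\gamma))$ (respectively $(\sigma,(\varepsilon,\beta,\gamma))$, $(\sigma,(\alpha,\beta,\varepsilon))$), with $\alpha,\beta,\gamma$ permutations of $Q$; here the superscript $A$ is just a symbol standing for "autotopy". These sets may be empty. For $v\in\{l,r,m\}$ and $i\in\{1,2,3\}$, ${}^{\sigma}_{i}N_v^A$ denotes the set of all $i$-th components $\alpha_i$ of elements $(\sigma,(\alpha_1,\alpha_2,\alpha_3))$ of ${}^{\sigma}N_v^A$. For subsets $B,C$ of a group, $BC=\{bc: b\in B,\ c\in C\}$; for nuclei the group is $Aus(Q,\cdot)$, for component sets it is the group of permutations of $Q$. *)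

theory Defs
  imports "HOL-Combinatorics.Permutations" "HOL-Algebra.Coset"
begin

text \<open>
  The symmetric group $S_3$ is the set of functions \<open>\<sigma>\<close> with \<open>\<sigma> permutes {1, 2, 3}\<close>, and its
  products are read from left to right: $\sigma\tau$ is \<open>\<tau> \<circ> \<sigma>\<close>. Permutations of \<open>Q\<close> are
  functions \<open>\<alpha>\<close> with \<open>\<alpha> permutes Q\<close> (so \<open>\<epsilon>\<close> is \<open>id\<close>), and they compose as functions.
  The inverse function is written \<open>inv_into UNIV\<close>, because HOL-Algebra uses \<open>inv\<close> for the
  inverse in a group record.
\<close>

locale quasigroup =
  fixes Q :: "'a set" and A :: "'a \<Rightarrow> 'a \<Rightarrow> 'a"
  assumes closed: "\<lbrakk>a \<in> Q; b \<in> Q\<rbrakk> \<Longrightarrow> A a b \<in> Q"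
    and left_solvable: "\<lbrakk>a \<in> Q; b \<in> Q\<rbrakk> \<Longrightarrow> \<exists>!x. x \<in> Q \<and> A x a = b"
    and right_solvable: "\<lbrakk>a \<in> Q; b \<in> Q\<rbrakk> \<Longrightarrow> \<exists>!y. y \<in> Q \<and> A a y = b"

type_synonym 'a triple = "'a \<times> 'a \<times> 'a"

fun component :: "nat \<Rightarrow> 'a triple \<Rightarrow> 'a" where
  "component i (x1, x2, x3) = (if i = 1 then x1 else if i = 2 then x2 else x3)"

text \<open>The triple $R^\tau$ whose \<open>i\<close>-th component is component $\tau^{-1}i$ of \<open>R\<close>.\<close>

definition permute_triple :: "'a triple \<Rightarrow> (nat \<Rightarrow> nat) \<Rightarrow> 'a triple" where
  "permute_triple R \<tau> =
     (component (inv_into UNIV \<tau> 1) R,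
      component (inv_into UNIV \<tau> 2) R,
      component (inv_into UNIV \<tau> 3) R)"

fun triple_mult :: "('a \<Rightarrow> 'a) triple \<Rightarrow> ('a \<Rightarrow> 'a) triple \<Rightarrow> ('a \<Rightarrow> 'a) triple" where
  "triple_mult (\<alpha>1, \<alpha>2, \<alpha>3) (\<beta>1, \<beta>2, \<beta>3) = (\<alpha>1 \<circ> \<beta>1, \<alpha>2 \<circ> \<beta>2, \<alpha>3 \<circ> \<beta>3)"

text \<open>
  The graph of the \<open>\<sigma>\<close>-parastrophe consists of the triples $x^\sigma$ with \<open>x\<close> in the graph of
  \<open>A\<close>; see \<open>parastrophe_iff\<close> below. Values at arguments outside \<open>Q\<close> are irrelevant.
\<close>

definition parastrophe ::
    "'a set \<Rightarrow> ('a \<Rightarrow> 'a \<Rightarrow> 'a) \<Rightarrow> (nat \<Rightarrow> nat) \<Rightarrow> 'a \<Rightarrow> 'a \<Rightarrow> 'a" where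
  "parastrophe Q A \<sigma> y1 y2 =
     (THE y3. \<exists>x1\<in>Q. \<exists>x2\<in>Q. \<exists>x3\<in>Q.
        A x1 x2 = x3 \<and> permute_triple (x1, x2, x3) \<sigma> = (y1, y2, y3))"

fun isostrophic_image ::
    "'a set \<Rightarrow> ('a \<Rightarrow> 'a \<Rightarrow> 'a) \<Rightarrow> (nat \<Rightarrow> nat) \<times> ('a \<Rightarrow> 'a) triple \<Rightarrow> 'a \<Rightarrow> 'a \<Rightarrow> 'a" where
  "isostrophic_image Q A (\<sigma>, (\<alpha>1, \<alpha>2, \<alpha>3)) x1 x2 =
     inv_into UNIV \<alpha>3 (parastrophe Q A \<sigma> (\<alpha>1 x1) (\<alpha>2 x2))"

definition Aus ::
    "'a set \<Rightarrow> ('a \<Rightarrow> 'a \<Rightarrow> 'a) \<Rightarrow> ((nat \<Rightarrow> nat) \<times> ('a \<Rightarrow> 'a) triple) monoid" where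
  "Aus Q A =
     \<lparr>carrier = {(\<sigma>, (\<alpha>1, \<alpha>2, \<alpha>3)).
        \<sigma> permutes {1, 2, 3} \<and> \<alpha>1 permutes Q \<and> \<alpha>2 permutes Q \<and> \<alpha>3 permutes Q \<and>
        (\<forall>x1\<in>Q. \<forall>x2\<in>Q. isostrophic_image Q A (\<sigma>, (\<alpha>1, \<alpha>2, \<alpha>3)) x1 x2 = A x1 x2)},
      mult = (\<lambda>(\<sigma>, R) (\<tau>, S). (\<tau> \<circ> \<sigma>, triple_mult (permute_triple R \<tau>) S)),
      one = (id, (id, id, id))\<rparr>"

definition perm_group :: "'a set \<Rightarrow> ('a \<Rightarrow> 'a) monoid" where
  "perm_group Q = \<lparr>carrier = {p. p permutes Q}, mult = (\<circ>), one = id\<rparr>"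

datatype nucleus_kind = Left | Right | Middle

fun nucleus :: "'a set \<Rightarrow> ('a \<Rightarrow> 'a \<Rightarrow> 'a) \<Rightarrow> (nat \<Rightarrow> nat) \<Rightarrow> nucleus_kind \<Rightarrow>
    ((nat \<Rightarrow> nat) \<times> ('a \<Rightarrow> 'a) triple) set" where
  "nucleus Q A \<sigma> Left = {(\<sigma>, (\<alpha>, id, \<gamma>)) | \<alpha> \<gamma>. (\<sigma>, (\<alpha>, id, \<gamma>)) \<in> carrier (Aus Q A)}"
| "nucleus Q A \<sigma> Right = {(\<sigma>, (id, \<beta>, \<gamma>)) | \<beta> \<gamma>. (\<sigma>, (id, \<beta>, \<gamma>)) \<in> carrier (Aus Q A)}"
| "nucleus Q A \<sigma> Middle = {(\<sigma>, (\<alpha>, \<beta>, id)) | \<alpha> \<beta>. (\<sigma>, (\<alpha>, \<beta>, id)) \<in> carrier (Aus Q A)}"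

definition nucleus_component :: "'a set \<Rightarrow> ('a \<Rightarrow> 'a \<Rightarrow> 'a) \<Rightarrow> (nat \<Rightarrow> nat) \<Rightarrow> nat \<Rightarrow>
    nucleus_kind \<Rightarrow> ('a \<Rightarrow> 'a) set" where
  "nucleus_component Q A \<sigma> i v = (\<lambda>(_, R). component i R) ` nucleus Q A \<sigma> v"

definition kind_at :: "nat \<Rightarrow> nucleus_kind" where
  "kind_at j = (if j = 1 then Right else if j = 2 then Left else Middle)"


lemma component_permute_triple:
  assumes "\<sigma> permutes {1, 2, 3}" "i \<in> {1, 2, 3}"
  shows "component i (permute_triple R \<sigma>) = component (inv_into UNIV \<sigma> i) R"
  using assms(2) by (auto simp: permute_triple_def)

lemma triple_eqI:
  assumes "\<And>i. i \<in> {1, 2, 3} \<Longrightarrow> component i x = component i y"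
  shows "x = y"
  using assms[of 1] assms[of 2] assms[of 3] by (cases x; cases y) auto

lemma component_mem:
  assumes "x \<in> Q \<times> Q \<times> Q"
  shows "component i x \<in> Q"
  using assms by (cases x) auto

lemma permute_triple_mem:
  assumes "x \<in> Q \<times> Q \<times> Q"
  shows "permute_triple x \<sigma> \<in> Q \<times> Q \<times> Q"
  using assms by (auto simp: permute_triple_def intro!: component_mem[of "(_, _, _)"])

lemma permute_triple_mult:
  assumes "\<sigma> permutes {1, 2, 3}" "\<tau> permutes {1, 2, 3}"
  shows "permute_triple (permute_triple x \<sigma>) \<tau> = permute_triple x (\<tau> \<circ> \<sigma>)"
proof (rule triple_eqI)
  fix i :: nat assume i: "i \<in> {1, 2, 3}"
  have "inv_into UNIV \<tau> i \<in> {1, 2, 3}"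
    using i permutes_in_image[OF permutes_inv[OF assms(2)]] by blast
  moreover have "inv_into UNIV (\<tau> \<circ> \<sigma>) = inv_into UNIV \<sigma> \<circ> inv_into UNIV \<tau>"
    using assms permutes_bij o_inv_distrib by blast
  ultimately show "component i (permute_triple (permute_triple x \<sigma>) \<tau>)
      = component i (permute_triple x (\<tau> \<circ> \<sigma>))"
    using i assms permutes_compose[OF assms]
    by (simp only: component_permute_triple o_apply)
qed

lemma permute_triple_id: "permute_triple x id = x"
  by (cases x) (simp add: permute_triple_def)

lemma permute_triple_eq_iff:
  assumes "\<sigma> permutes {1, 2, 3}"
  shows "permute_triple x \<sigma> = y \<longleftrightarrow> x = permute_triple y (inv_into UNIV \<sigma>)"
  using assms permutes_inv[OF assms]
  by (metis permute_triple_mult permute_triple_id permutes_inv_o)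

context quasigroup
begin

lemma component_determined:
  assumes "x \<in> Q \<times> Q \<times> Q" "y \<in> Q \<times> Q \<times> Q"
    and "A (component 1 x) (component 2 x) = component 3 x"
    and "A (component 1 y) (component 2 y) = component 3 y"
    and "k \<in> {1, 2, 3}"
    and "\<And>i. i \<in> {1, 2, 3} \<Longrightarrow> i \<noteq> k \<Longrightarrow> component i x = component i y"
  shows "x = y"
proof -
  have left: "a = a'" if "A a b = A a' b" "a \<in> Q" "a' \<in> Q" "b \<in> Q" for a a' b
    using left_solvable[of b "A a b"] closed[of a b] that by metis
  have right: "b = b'" if "A a b = A a b'" "a \<in> Q" "b \<in> Q" "b' \<in> Q" for a b b'
    using right_solvable[of a "A a b"] closed[of a b] that by metis
  obtain a b where x: "x = (a, b, A a b)" "a \<in> Q" "b \<in> Q"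
    using assms(1,3) by (cases x) auto
  obtain a' b' where y: "y = (a', b', A a' b')" "a' \<in> Q" "b' \<in> Q"
    using assms(2,4) by (cases y) auto
  consider "k = 1" | "k = 2" | "k = 3" using assms(5) by auto
  then show ?thesis
  proof cases
    case 1
    then have "b = b'" "A a b = A a' b'" using assms(6)[of 2] assms(6)[of 3] x y by auto
    then show ?thesis using left[of a b a'] x y by simp
  next
    case 2
    then have "a = a'" "A a b = A a' b'" using assms(6)[of 1] assms(6)[of 3] x y by auto
    then show ?thesis using right[of a b b'] x y by simp
  next
    case 3
    then show ?thesis using assms(6)[of 1] assms(6)[of 2] x y by auto
  qed
qed

lemma ex_component:
  assumes "x \<in> Q \<times> Q \<times> Q" "k \<in> {1, 2, 3}"
  shows "\<exists>y\<in>Q \<times> Q \<times> Q. A (component 1 y) (component 2 y) = component 3 y \<and>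
    (\<forall>i\<in>{1, 2, 3}. i \<noteq> k \<longrightarrow> component i y = component i x)"
proof -
  obtain a b c where x: "x = (a, b, c)" "a \<in> Q" "b \<in> Q" "c \<in> Q"
    using assms(1) by (cases x) auto
  obtain d where d: "d \<in> Q" "A d b = c" using left_solvable[of b c] x by blast
  obtain e where e: "e \<in> Q" "A a e = c" using right_solvable[of a c] x by blast
  consider "k = 1" | "k = 2" | "k = 3" using assms(2) by auto
  then show ?thesis
  proof cases
    case 1 show ?thesis by (rule bexI[of _ "(d, b, c)"]) (use 1 x d in auto)
  next
    case 2 show ?thesis by (rule bexI[of _ "(a, e, c)"]) (use 2 x e in auto)
  next
    case 3 show ?thesis
      by (rule bexI[of _ "(a, b, A a b)"]) (use 3 x closed in auto)
  qed
qed

lemma parastrophe_unique: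
  assumes \<sigma>: "\<sigma> permutes {1, 2, 3}" and y: "y1 \<in> Q" "y2 \<in> Q"
  shows "\<exists>!y3. \<exists>x1\<in>Q. \<exists>x2\<in>Q. \<exists>x3\<in>Q.
    A x1 x2 = x3 \<and> permute_triple (x1, x2, x3) \<sigma> = (y1, y2, y3)"
proof (rule ex_ex1I)
  let ?k = "inv_into UNIV \<sigma> 3"
  have inv_mem: "inv_into UNIV \<sigma> j \<in> {1, 2, 3}" if "j \<in> {1, 2, 3}" for j
    using that permutes_in_image[OF permutes_inv[OF \<sigma>]] by blast
  have k: "?k \<in> {1, 2, 3}" by (rule inv_mem) simp
  have s: "component i (permute_triple z (inv_into UNIV \<sigma>)) = component (\<sigma> i) z"
    if "i \<in> {1, 2, 3}" for i and z :: "'a triple"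
    using component_permute_triple[OF permutes_inv[OF \<sigma>] that] permutes_inv_inv[OF \<sigma>] by simp
  have ne: "\<sigma> i = 1 \<or> \<sigma> i = 2" if "i \<in> {1, 2, 3}" "i \<noteq> ?k" for i
  proof -
    have "\<sigma> i \<in> {1, 2, 3}" using permutes_in_image[OF \<sigma>] that(1) by blast
    moreover have "\<sigma> i \<noteq> 3" using permutes_inverses(2)[OF \<sigma>, of i] that(2) by metis
    ultimately show ?thesis by blast
  qed
  let ?x = "permute_triple (y1, y2, y1) (inv_into UNIV \<sigma>)"
  have x: "?x \<in> Q \<times> Q \<times> Q" by (rule permute_triple_mem) (use y in auto)
  obtain z where z: "z \<in> Q \<times> Q \<times> Q" "A (component 1 z) (component 2 z) = component 3 z"
    "\<forall>i\<in>{1, 2, 3}. i \<noteq> ?k \<longrightarrow> component i z = component i ?x"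
    using ex_component[OF x k] by (elim bexE conjE)
  have *: "component j (permute_triple z \<sigma>) = component j (y1, y2, y1)" if "j \<in> {1, 2}" for j
  proof -
    have j: "j \<in> {1, 2, 3}" "j \<noteq> 3" using that by auto
    have "inv_into UNIV \<sigma> j \<noteq> ?k"
      using j(2) permutes_inverses(1)[OF \<sigma>] by metis
    then have "component (inv_into UNIV \<sigma> j) z = component (inv_into UNIV \<sigma> j) ?x"
      using z(3) inv_mem[OF j(1)] by blast
    also have "\<dots> = component j (y1, y2, y1)"
      unfolding s[OF inv_mem[OF j(1)]] permutes_inverses(1)[OF \<sigma>] ..
    finally show ?thesis unfolding component_permute_triple[OF \<sigma> j(1)] .
  qed
  have "permute_triple z \<sigma> = (y1, y2, component 3 (permute_triple z \<sigma>))"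
    using *[of 1] *[of 2] by (cases "permute_triple z \<sigma>") simp
  moreover obtain a b c where abc: "z = (a, b, c)" by (cases z)
  moreover have "a \<in> Q" "b \<in> Q" "c \<in> Q" "A a b = c" using z(1,2) abc by simp_all
  ultimately show "\<exists>y3. \<exists>x1\<in>Q. \<exists>x2\<in>Q. \<exists>x3\<in>Q.
      A x1 x2 = x3 \<and> permute_triple (x1, x2, x3) \<sigma> = (y1, y2, y3)"
    by blast
  have graph: "\<exists>u\<in>Q \<times> Q \<times> Q. A (component 1 u) (component 2 u) = component 3 u \<and>
      permute_triple u \<sigma> = w"
    if "\<exists>x1\<in>Q. \<exists>x2\<in>Q. \<exists>x3\<in>Q. A x1 x2 = x3 \<and> permute_triple (x1, x2, x3) \<sigma> = w" for w
  proof -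
    from that obtain x1 x2 where "x1 \<in> Q" "x2 \<in> Q" "A x1 x2 \<in> Q"
      "permute_triple (x1, x2, A x1 x2) \<sigma> = w" by blast
    then show ?thesis by (intro bexI[of _ "(x1, x2, A x1 x2)"]) simp_all
  qed
  fix c d
  assume "\<exists>x1\<in>Q. \<exists>x2\<in>Q. \<exists>x3\<in>Q. A x1 x2 = x3 \<and> permute_triple (x1, x2, x3) \<sigma> = (y1, y2, c)"
  then obtain u where u: "u \<in> Q \<times> Q \<times> Q" "A (component 1 u) (component 2 u) = component 3 u"
    "permute_triple u \<sigma> = (y1, y2, c)"
    using graph by blast
  assume "\<exists>x1\<in>Q. \<exists>x2\<in>Q. \<exists>x3\<in>Q. A x1 x2 = x3 \<and> permute_triple (x1, x2, x3) \<sigma> = (y1, y2, d)"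
  then obtain v where v: "v \<in> Q \<times> Q \<times> Q" "A (component 1 v) (component 2 v) = component 3 v"
    "permute_triple v \<sigma> = (y1, y2, d)"
    using graph by blast
  have "u = v"
  proof (rule component_determined[OF u(1) v(1) u(2) v(2) k])
    fix i :: nat assume i: "i \<in> {1, 2, 3}" "i \<noteq> ?k"
    have "component i u = component (\<sigma> i) (y1, y2, c)"
      using u(3) s[OF i(1)] permute_triple_eq_iff[OF \<sigma>] by metis
    moreover have "component i v = component (\<sigma> i) (y1, y2, d)"
      using v(3) s[OF i(1)] permute_triple_eq_iff[OF \<sigma>] by metis
    ultimately show "component i u = component i v" using ne[OF i] by auto
  qed
  then show "c = d" using u v by simp
qed

lemma parastrophe_iff:
  assumes "\<sigma> permutes {1, 2, 3}" "x1 \<in> Q" "x2 \<in> Q" "x3 \<in> Q"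
  shows "A x1 x2 = x3 \<longleftrightarrow>
    parastrophe Q A \<sigma> (component (inv_into UNIV \<sigma> 1) (x1, x2, x3))
        (component (inv_into UNIV \<sigma> 2) (x1, x2, x3))
      = component (inv_into UNIV \<sigma> 3) (x1, x2, x3)"
proof -
  let ?y = "\<lambda>i. component (inv_into UNIV \<sigma> i) (x1, x2, x3)"
  let ?P = "\<lambda>y3. \<exists>x1\<in>Q. \<exists>x2\<in>Q. \<exists>x3\<in>Q.
    A x1 x2 = x3 \<and> permute_triple (x1, x2, x3) \<sigma> = (?y 1, ?y 2, y3)"
  have mem: "?y i \<in> Q" for i using assms component_mem[of "(x1, x2, x3)"] by blast
  have ex1: "\<exists>!y3. ?P y3" by (rule parastrophe_unique[OF assms(1) mem mem])
  then have "parastrophe Q A \<sigma> (?y 1) (?y 2) = ?y 3 \<longleftrightarrow> ?P (?y 3)"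
    unfolding parastrophe_def using theI'[OF ex1] by (metis (no_types, lifting))
  moreover have "permute_triple u \<sigma> = (?y 1, ?y 2, ?y 3) \<longleftrightarrow> u = (x1, x2, x3)" for u
    using permute_triple_eq_iff[OF assms(1)] unfolding permute_triple_def by metis
  then have "?P (?y 3) \<longleftrightarrow> A x1 x2 = x3" using assms by auto
  ultimately show ?thesis by simp
qed

end

end

theory Submission
  imports Defs
begin

text \<open>
  The graph of \<open>A\<close> is the set of triples in \<open>Q \<times> Q \<times> Q\<close> with \<open>A x1 x2 = x3\<close>. A pair
  \<open>(\<sigma>, R)\<close> acts on the triples over \<open>Q\<close>: apply the permutations in \<open>R\<close> componentwise, then
  rearrange the entries by the inverse of \<open>\<sigma>\<close>. Unfolding the definition of a parastrophe shows
  that autostrophisms are exactly the pairs whose action preserves and reflects membership in the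
  graph (\<open>mem_Aus_iff\<close>), which puts the three coordinates on an equal footing. The multiplication
  of pairs is composition of actions, and the action of an autostrophism is onto; so for an
  autostrophism \<open>(\<tau>, S)\<close>, a pair \<open>(\<sigma>, R)\<close> is an autostrophism if and only if its product with
  \<open>(\<tau>, S)\<close> is one (\<open>mult_mem_Aus_iff\<close>).

  The nuclei of kinds \<open>r\<close>, \<open>l\<close>, \<open>m\<close> consist of the autostrophisms whose component 1, 2, 3,
  respectively, is the identity. Component \<open>i\<close> of $R^\tau S$ is the composite of component
  $\tau^{-1}i$ of \<open>R\<close> with component \<open>i\<close> of \<open>S\<close>. Hence, if component \<open>j\<close> of \<open>S\<close> is the identity,
  component \<open>j\<close> of the product is the identity exactly when component $\tau^{-1}j$ of \<open>R\<close> is.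
  This gives one inclusion between the product of the nuclei and the nucleus for $\sigma\tau$, and
  the other one follows by dividing an element of the latter on the right by any element of the
  nucleus for \<open>\<tau>\<close>. Since products are taken componentwise, the equation between nuclei
  projects to each component. The three parts are the cases \<open>j = 2\<close>, \<open>j = 1\<close>, \<open>j = 3\<close>.
\<close>

section \<open>The action of a pair on triples\<close>

definition graph :: "'a set \<Rightarrow> ('a \<Rightarrow> 'a \<Rightarrow> 'a) \<Rightarrow> 'a triple set" where
  "graph Q A = {x \<in> Q \<times> Q \<times> Q. A (component 1 x) (component 2 x) = component 3 x}"

fun apply_triple :: "('a \<Rightarrow> 'a) triple \<Rightarrow> 'a triple \<Rightarrow> 'a triple" where
  "apply_triple (\<alpha>1, \<alpha>2, \<alpha>3) (x1, x2, x3) = (\<alpha>1 x1, \<alpha>2 x2, \<alpha>3 x3)"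

text \<open>
  With this rearrangement, $y$ is the image of $x$ precisely when $y^\sigma$ is \<open>R\<close> applied to
  \<open>x\<close>; since $y \mapsto y^\sigma$ carries the graph of \<open>A\<close> to that of its parastrophe, the
  parastrophe disappears from the description of autostrophisms.
\<close>

definition act :: "(nat \<Rightarrow> nat) \<Rightarrow> ('a \<Rightarrow> 'a) triple \<Rightarrow> 'a triple \<Rightarrow> 'a triple" where
  "act \<sigma> R x = permute_triple (apply_triple R x) (inv_into UNIV \<sigma>)"

fun triple_inv :: "('a \<Rightarrow> 'a) triple \<Rightarrow> ('a \<Rightarrow> 'a) triple" where
  "triple_inv (\<alpha>1, \<alpha>2, \<alpha>3) = (inv_into UNIV \<alpha>1, inv_into UNIV \<alpha>2, inv_into UNIV \<alpha>3)"

definition perm_triple :: "'a set \<Rightarrow> ('a \<Rightarrow> 'a) triple \<Rightarrow> bool" where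
  "perm_triple Q R \<longleftrightarrow> (\<forall>i. component i R permutes Q)"

lemma perm_triple_iff [simp]:
  "perm_triple Q (\<alpha>1, \<alpha>2, \<alpha>3) \<longleftrightarrow> \<alpha>1 permutes Q \<and> \<alpha>2 permutes Q \<and> \<alpha>3 permutes Q"
proof
  assume R: "perm_triple Q (\<alpha>1, \<alpha>2, \<alpha>3)"
  then have "component i (\<alpha>1, \<alpha>2, \<alpha>3) permutes Q" for i by (simp add: perm_triple_def)
  from this[of 1] this[of 2] this[of 3]
  show "\<alpha>1 permutes Q \<and> \<alpha>2 permutes Q \<and> \<alpha>3 permutes Q" by simp
qed (simp add: perm_triple_def)

lemma component_triple_mult: "component i (triple_mult R S) = component i R \<circ> component i S"
  by (cases R; cases S) simp

lemma component_apply_triple: "component i (apply_triple R x) = component i R (component i x)"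
  by (cases R; cases x) simp

lemma component_triple_inv: "component i (triple_inv R) = inv_into UNIV (component i R)"
  by (cases R) simp

lemma permute_apply_triple:
  "permute_triple (apply_triple R x) \<tau> = apply_triple (permute_triple R \<tau>) (permute_triple x \<tau>)"
  by (simp add: permute_triple_def component_apply_triple)

lemma apply_triple_mult: "apply_triple (triple_mult R S) x = apply_triple R (apply_triple S x)"
  by (cases R; cases S; cases x) simp

lemma triple_mult_assoc: "triple_mult (triple_mult R S) T = triple_mult R (triple_mult S T)"
  by (cases R; cases S; cases T) (simp add: comp_assoc)

lemma triple_mult_inv:
  assumes "perm_triple Q R"
  shows "triple_mult R (triple_inv R) = (id, id, id)" "triple_mult (triple_inv R) R = (id, id, id)"
proof -
  obtain \<alpha>1 \<alpha>2 \<alpha>3 where R: "R = (\<alpha>1, \<alpha>2, \<alpha>3)" by (cases R)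
  then show "triple_mult R (triple_inv R) = (id, id, id)"
    and "triple_mult (triple_inv R) R = (id, id, id)"
    using assms by (simp_all add: permutes_inv_o[of _ Q])
qed

lemma triple_mult_id: "triple_mult R (id, id, id) = R"
  by (cases R) simp

lemma perm_triple_mult:
  assumes "perm_triple Q R" "perm_triple Q S"
  shows "perm_triple Q (triple_mult R S)"
  using assms by (simp add: perm_triple_def component_triple_mult permutes_compose)

lemma perm_triple_inv:
  assumes "perm_triple Q R"
  shows "perm_triple Q (triple_inv R)"
  using assms by (simp add: perm_triple_def component_triple_inv permutes_inv)

lemma perm_triple_permute:
  assumes "perm_triple Q R"
  shows "perm_triple Q (permute_triple R \<tau>)"
  using assms by (simp add: permute_triple_def perm_triple_def)

lemma permute_triple_cancel:
  assumes "\<tau> permutes {1, 2, 3}"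
  shows "permute_triple (permute_triple x \<tau>) (inv_into UNIV \<tau>) = x"
    and "permute_triple (permute_triple x (inv_into UNIV \<tau>)) \<tau> = x"
  using permute_triple_eq_iff[OF assms] by metis+

lemma apply_triple_mem:
  assumes "perm_triple Q R" "x \<in> Q \<times> Q \<times> Q"
  shows "apply_triple R x \<in> Q \<times> Q \<times> Q"
  using assms by (cases R; cases x) (auto simp: permutes_in_image)

lemma act_mem:
  assumes "perm_triple Q R" "x \<in> Q \<times> Q \<times> Q"
  shows "act \<sigma> R x \<in> Q \<times> Q \<times> Q"
  unfolding act_def by (intro permute_triple_mem apply_triple_mem assms)

lemma act_surj:
  assumes "\<sigma> permutes {1, 2, 3}" "perm_triple Q R" "y \<in> Q \<times> Q \<times> Q"
  obtains x where "x \<in> Q \<times> Q \<times> Q" "act \<sigma> R x = y"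
proof
  let ?x = "apply_triple (triple_inv R) (permute_triple y \<sigma>)"
  show "?x \<in> Q \<times> Q \<times> Q"
    by (intro apply_triple_mem perm_triple_inv permute_triple_mem assms)
  have "apply_triple R ?x = permute_triple y \<sigma>"
    unfolding apply_triple_mult[symmetric] triple_mult_inv[OF assms(2)]
    by (cases "permute_triple y \<sigma>") simp
  then show "act \<sigma> R ?x = y"
    unfolding act_def using permute_triple_cancel[OF assms(1)] by simp
qed

text \<open>
  Multiplication in \<open>Aus\<close> is composition of actions because rearranging the result of \<open>S\<close> by
  the inverse of \<open>\<tau>\<close> and then applying \<open>R\<close> is the same as applying $R^\tau$ first.
\<close>

lemma act_mult:
  assumes "\<sigma> permutes {1, 2, 3}" "\<tau> permutes {1, 2, 3}"
  shows "act (\<tau> \<circ> \<sigma>) (triple_mult (permute_triple R \<tau>) S) x = act \<sigma> R (act \<tau> S x)"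
proof -
  have "inv_into UNIV (\<tau> \<circ> \<sigma>) = inv_into UNIV \<sigma> \<circ> inv_into UNIV \<tau>"
    using assms permutes_bij o_inv_distrib by blast
  then show ?thesis
    unfolding act_def apply_triple_mult
    using assms
    by (simp add: permute_triple_mult[symmetric] permutes_inv permute_apply_triple
        permute_triple_cancel)
qed

section \<open>Autostrophisms as symmetries of the graph\<close>

context quasigroup
begin

lemma act_mem_graph_iff:
  assumes \<sigma>: "\<sigma> permutes {1, 2, 3}" and R: "perm_triple Q R" and x: "x \<in> Q \<times> Q \<times> Q"
  shows "act \<sigma> R x \<in> graph Q A \<longleftrightarrow>
    parastrophe Q A \<sigma> (component 1 (apply_triple R x)) (component 2 (apply_triple R x))
      = component 3 (apply_triple R x)"
proof -
  obtain y1 y2 y3 where y: "act \<sigma> R x = (y1, y2, y3)" by (cases "act \<sigma> R x")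
  have mem: "y1 \<in> Q" "y2 \<in> Q" "y3 \<in> Q" using act_mem[OF R x, of \<sigma>] y by auto
  have "permute_triple (y1, y2, y3) \<sigma> = apply_triple R x"
    using y permute_triple_cancel(2)[OF \<sigma>] unfolding act_def by metis
  then have "component (inv_into UNIV \<sigma> i) (y1, y2, y3) = component i (apply_triple R x)"
    if "i \<in> {1, 2, 3}" for i
    using component_permute_triple[OF \<sigma> that] by metis
  then show ?thesis
    using parastrophe_iff[OF \<sigma> mem] mem by (simp add: graph_def y)
qed

text \<open>
  The defining equation of an autostrophism says that \<open>act \<sigma> R\<close> maps the graph into itself; as
  \<open>\<alpha>3\<close> is injective and the parastrophe is single-valued, it also reflects membership.
\<close>

lemma mem_Aus_iff:
  "(\<sigma>, R) \<in> carrier (Aus Q A) \<longleftrightarrow> \<sigma> permutes {1, 2, 3} \<and> perm_triple Q R \<and>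
    (\<forall>x\<in>Q \<times> Q \<times> Q. act \<sigma> R x \<in> graph Q A \<longleftrightarrow> x \<in> graph Q A)"
proof (cases "\<sigma> permutes {1, 2, 3} \<and> perm_triple Q R")
  case False
  then show ?thesis by (cases R) (auto simp: Aus_def)
next
  case True
  obtain \<alpha>1 \<alpha>2 \<alpha>3 where R: "R = (\<alpha>1, \<alpha>2, \<alpha>3)" by (cases R)
  let ?B = "\<lambda>x1 x2. parastrophe Q A \<sigma> (\<alpha>1 x1) (\<alpha>2 x2)"
  have \<alpha>3: "\<alpha>3 permutes Q" using True R by simp
  have "(\<sigma>, R) \<in> carrier (Aus Q A) \<longleftrightarrow> (\<forall>x1\<in>Q. \<forall>x2\<in>Q. ?B x1 x2 = \<alpha>3 (A x1 x2))"
    using True permutes_inv_eq[OF \<alpha>3] by (auto simp: Aus_def R)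
  also have "\<dots> \<longleftrightarrow> (\<forall>x1\<in>Q. \<forall>x2\<in>Q. \<forall>x3\<in>Q. ?B x1 x2 = \<alpha>3 x3 \<longleftrightarrow> A x1 x2 = x3)"
    using closed permutes_inj[OF \<alpha>3] by (auto simp: inj_eq)
  also have "\<dots> \<longleftrightarrow> (\<forall>x\<in>Q \<times> Q \<times> Q. act \<sigma> R x \<in> graph Q A \<longleftrightarrow> x \<in> graph Q A)"
  proof -
    have "(act \<sigma> R (x1, x2, x3) \<in> graph Q A \<longleftrightarrow> (x1, x2, x3) \<in> graph Q A) \<longleftrightarrow>
        (?B x1 x2 = \<alpha>3 x3 \<longleftrightarrow> A x1 x2 = x3)" if "x1 \<in> Q" "x2 \<in> Q" "x3 \<in> Q" for x1 x2 x3
      using act_mem_graph_iff[of \<sigma> R "(x1, x2, x3)"] True that by (simp add: R graph_def)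
    then show ?thesis by auto
  qed
  finally show ?thesis using True by simp
qed

text \<open>
  The equivalence is what makes division work: the forward direction is closure of \<open>Aus\<close> under
  products, the backward one lets an autostrophism be cancelled on the right.
\<close>

lemma mult_mem_Aus_iff:
  assumes \<sigma>: "\<sigma> permutes {1, 2, 3}" and R: "perm_triple Q R"
    and S: "(\<tau>, S) \<in> carrier (Aus Q A)"
  shows "(\<tau> \<circ> \<sigma>, triple_mult (permute_triple R \<tau>) S) \<in> carrier (Aus Q A) \<longleftrightarrow>
    (\<sigma>, R) \<in> carrier (Aus Q A)"
proof -
  have \<tau>: "\<tau> permutes {1, 2, 3}" and perm: "perm_triple Q S"
    and inv: "\<And>x. x \<in> Q \<times> Q \<times> Q \<Longrightarrow> act \<tau> S x \<in> graph Q A \<longleftrightarrow> x \<in> graph Q A"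
    using S unfolding mem_Aus_iff by auto
  have "(\<tau> \<circ> \<sigma>, triple_mult (permute_triple R \<tau>) S) \<in> carrier (Aus Q A) \<longleftrightarrow>
      (\<forall>x\<in>Q \<times> Q \<times> Q. act \<sigma> R (act \<tau> S x) \<in> graph Q A \<longleftrightarrow> act \<tau> S x \<in> graph Q A)"
    unfolding mem_Aus_iff act_mult[OF \<sigma> \<tau>]
    using permutes_compose[OF \<sigma> \<tau>] perm_triple_mult[OF perm_triple_permute[OF R] perm] inv
    by simp
  also have "\<dots> \<longleftrightarrow> (\<forall>y\<in>Q \<times> Q \<times> Q. act \<sigma> R y \<in> graph Q A \<longleftrightarrow> y \<in> graph Q A)"
    using act_mem[OF perm, of _ \<tau>] act_surj[OF \<tau> perm] by metis
  finally show ?thesis using \<sigma> R unfolding mem_Aus_iff by simp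
qed

end

section \<open>Products of nuclei\<close>

lemma Aus_mult:
  "(\<sigma>, R) \<otimes>\<^bsub>Aus Q A\<^esub> (\<tau>, S) = (\<tau> \<circ> \<sigma>, triple_mult (permute_triple R \<tau>) S)"
  by (simp add: Aus_def)

text \<open>
  Indexing the three kinds by the coordinate of the identity component replaces the three nuclei
  by one notion, on which permutations of the coordinates can act.
\<close>

lemma mem_nucleus_iff:
  assumes "j \<in> {1, 2, 3}"
  shows "(\<rho>, R) \<in> nucleus Q A \<sigma> (kind_at j) \<longleftrightarrow>
    \<rho> = \<sigma> \<and> (\<sigma>, R) \<in> carrier (Aus Q A) \<and> component j R = id"
  using assms by (cases R) (auto simp: kind_at_def)

context quasigroup
begin

text \<open>
  Component \<open>j\<close> of $R^\tau S$ is the composite of component $\tau^{-1}j$ of \<open>R\<close> and component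
  \<open>j\<close> of \<open>S\<close>, so the kind of the left factor is dictated by $\tau^{-1}j$. Every element of the
  product nucleus is reached with one and the same right factor \<open>S\<close>.
\<close>

theorem nucleus_mult:
  assumes \<sigma>: "\<sigma> permutes {1, 2, 3}" and \<tau>: "\<tau> permutes {1, 2, 3}" and j: "j \<in> {1, 2, 3}"
    and ne: "nucleus Q A \<tau> (kind_at j) \<noteq> {}"
  shows "nucleus Q A \<sigma> (kind_at (inv_into UNIV \<tau> j)) <#>\<^bsub>Aus Q A\<^esub> nucleus Q A \<tau> (kind_at j)
    = nucleus Q A (\<tau> \<circ> \<sigma>) (kind_at j)"
proof -
  let ?k = "inv_into UNIV \<tau> j"
  have k: "?k \<in> {1, 2, 3}" using j permutes_in_image[OF permutes_inv[OF \<tau>]] by blast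
  have comp: "component j (triple_mult (permute_triple R \<tau>) S) = component ?k R \<circ> component j S"
    for R S :: "('a \<Rightarrow> 'a) triple"
    by (simp only: component_triple_mult component_permute_triple[OF \<tau> j])
  show ?thesis
  proof (intro equalityI subsetI)
    fix g assume "g \<in> nucleus Q A \<sigma> (kind_at ?k) <#>\<^bsub>Aus Q A\<^esub> nucleus Q A \<tau> (kind_at j)"
    then obtain \<rho> R \<pi> S where RS': "(\<rho>, R) \<in> nucleus Q A \<sigma> (kind_at ?k)"
      "(\<pi>, S) \<in> nucleus Q A \<tau> (kind_at j)" "g = (\<rho>, R) \<otimes>\<^bsub>Aus Q A\<^esub> (\<pi>, S)"
      unfolding set_mult_def by (metis (no_types, lifting) UN_E singletonD prod.collapse)
    have RS: "(\<sigma>, R) \<in> carrier (Aus Q A)" "component ?k R = id"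
      "(\<tau>, S) \<in> carrier (Aus Q A)" "component j S = id" "\<rho> = \<sigma>" "\<pi> = \<tau>"
      using RS'(1,2) unfolding mem_nucleus_iff[OF j] mem_nucleus_iff[OF k] by blast+
    have g: "g = (\<tau> \<circ> \<sigma>, triple_mult (permute_triple R \<tau>) S)"
      unfolding RS'(3) RS(5,6) by (rule Aus_mult)
    have "perm_triple Q R" using RS(1) unfolding mem_Aus_iff by simp
    then have "g \<in> carrier (Aus Q A)" using mult_mem_Aus_iff[OF \<sigma> _ RS(3)] RS(1) g by simp
    then show "g \<in> nucleus Q A (\<tau> \<circ> \<sigma>) (kind_at j)"
      unfolding g mem_nucleus_iff[OF j] comp RS(2,4) by simp
  next
    fix g assume "g \<in> nucleus Q A (\<tau> \<circ> \<sigma>) (kind_at j)"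
    then obtain T where T: "(\<tau> \<circ> \<sigma>, T) \<in> carrier (Aus Q A)" "component j T = id"
      and g: "g = (\<tau> \<circ> \<sigma>, T)"
      using mem_nucleus_iff[OF j] by (metis prod.collapse)
    obtain S where S: "(\<tau>, S) \<in> carrier (Aus Q A)" "component j S = id"
      using ne mem_nucleus_iff[OF j] by (metis ex_in_conv surj_pair)
    have perm: "perm_triple Q S" "perm_triple Q T" using S(1) T(1) unfolding mem_Aus_iff by auto
    \<comment> \<open>Solve $R^\tau S = T$ for \<open>R\<close>.\<close>
    define R where "R = permute_triple (triple_mult T (triple_inv S)) (inv_into UNIV \<tau>)"
    have R: "perm_triple Q R"
      unfolding R_def by (intro perm_triple_permute perm_triple_mult perm_triple_inv perm)
    have RS: "triple_mult (permute_triple R \<tau>) S = T"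
      unfolding R_def permute_triple_cancel(2)[OF \<tau>] triple_mult_assoc triple_mult_inv[OF perm(1)]
      by (rule triple_mult_id)
    have "(\<sigma>, R) \<in> carrier (Aus Q A)" using mult_mem_Aus_iff[OF \<sigma> R S(1)] T(1) RS by simp
    moreover have "component ?k R = id" using comp[of R S] RS T(2) S(2) by simp
    ultimately have "(\<sigma>, R) \<in> nucleus Q A \<sigma> (kind_at ?k)" "(\<tau>, S) \<in> nucleus Q A \<tau> (kind_at j)"
      unfolding mem_nucleus_iff[OF j] mem_nucleus_iff[OF k] using S by blast+
    moreover have "g = (\<sigma>, R) \<otimes>\<^bsub>Aus Q A\<^esub> (\<tau>, S)" unfolding Aus_mult RS g ..
    ultimately show "g \<in> nucleus Q A \<sigma> (kind_at ?k) <#>\<^bsub>Aus Q A\<^esub> nucleus Q A \<tau> (kind_at j)"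
      unfolding set_mult_def by blast
  qed
qed

end

text \<open>
  Taking component \<open>i\<close> turns a product of pairs into a product of permutations, with component
  $\tau^{-1}i$ from the left factor. All right factors must share the same \<open>\<tau>\<close> for this to
  hold for sets, which is why the right factor is a nucleus, while \<open>N\<close> is arbitrary.
\<close>

lemma component_set_mult:
  assumes \<tau>: "\<tau> permutes {1, 2, 3}" and i: "i \<in> {1, 2, 3}" and j: "j \<in> {1, 2, 3}"
  shows "(\<lambda>(_, R). component i R) ` (N <#>\<^bsub>Aus Q A\<^esub> nucleus Q A \<tau> (kind_at j))
    = (\<lambda>(_, R). component (inv_into UNIV \<tau> i) R) ` N
        <#>\<^bsub>perm_group Q\<^esub> nucleus_component Q A \<tau> i (kind_at j)"
  (is "?f ` (N <#>\<^bsub>_\<^esub> ?M) = ?R")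
proof -
  let ?k = "inv_into UNIV \<tau> i"
  have comp: "component i (snd (g \<otimes>\<^bsub>Aus Q A\<^esub> h)) = component ?k (snd g) \<circ> component i (snd h)"
    if "h \<in> ?M" for g h
  proof -
    obtain \<rho> R where g: "g = (\<rho>, R)" by (cases g)
    obtain \<pi> S where "h = (\<pi>, S)" by (cases h)
    then have h: "h = (\<tau>, S)" using that mem_nucleus_iff[OF j] by metis
    show ?thesis
      unfolding g h Aus_mult snd_conv component_triple_mult component_permute_triple[OF \<tau> i] ..
  qed
  have "?f ` (N <#>\<^bsub>Aus Q A\<^esub> ?M) = (\<Union>g\<in>N. \<Union>h\<in>?M. {component i (snd (g \<otimes>\<^bsub>Aus Q A\<^esub> h))})"
    unfolding set_mult_def case_prod_beta' by blast
  also have "\<dots> = (\<Union>g\<in>N. \<Union>h\<in>?M. {component ?k (snd g) \<circ> component i (snd h)})"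
    by (intro SUP_cong refl) (simp only: comp)
  also have "\<dots> = ?R"
    unfolding set_mult_def nucleus_component_def case_prod_beta' perm_group_def monoid.simps
    by blast
  finally show ?thesis .
qed

corollary (in quasigroup) nucleus_component_mult:
  assumes "\<sigma> permutes {1, 2, 3}" "\<tau> permutes {1, 2, 3}" "i \<in> {1, 2, 3}" "j \<in> {1, 2, 3}"
    and "nucleus Q A \<tau> (kind_at j) \<noteq> {}"
  shows "nucleus_component Q A \<sigma> (inv_into UNIV \<tau> i) (kind_at (inv_into UNIV \<tau> j))
      <#>\<^bsub>perm_group Q\<^esub> nucleus_component Q A \<tau> i (kind_at j)
    = nucleus_component Q A (\<tau> \<circ> \<sigma>) i (kind_at j)"
  using component_set_mult[OF assms(2,3,4),
      where N = "nucleus Q A \<sigma> (kind_at (inv_into UNIV \<tau> j))" and Q = Q and A = A]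
  unfolding nucleus_mult[OF assms(1,2,4,5)] nucleus_component_def by (rule sym)

theorem theorem3:
  fixes Q :: "'a set" and A :: "'a \<Rightarrow> 'a \<Rightarrow> 'a" and \<sigma> \<tau> :: "nat \<Rightarrow> nat"
  assumes "quasigroup Q A"
    and "\<sigma> permutes {1, 2, 3}" and "\<tau> permutes {1, 2, 3}"
  shows
   "(let v = kind_at (inv_into UNIV \<tau> 2) in
      nucleus Q A \<sigma> v \<noteq> {} \<longrightarrow> nucleus Q A \<tau> Left \<noteq> {} \<longrightarrow>
        nucleus Q A \<sigma> v <#>\<^bsub>Aus Q A\<^esub> nucleus Q A \<tau> Left = nucleus Q A (\<tau> \<circ> \<sigma>) Left \<and>
        nucleus_component Q A \<sigma> (inv_into UNIV \<tau> 1) v <#>\<^bsub>perm_group Q\<^esub> nucleus_component Q A \<tau> 1 Left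
          = nucleus_component Q A (\<tau> \<circ> \<sigma>) 1 Left \<and>
        nucleus_component Q A \<sigma> (inv_into UNIV \<tau> 3) v <#>\<^bsub>perm_group Q\<^esub> nucleus_component Q A \<tau> 3 Left
          = nucleus_component Q A (\<tau> \<circ> \<sigma>) 3 Left) \<and>
    (let v = kind_at (inv_into UNIV \<tau> 1) in
      nucleus Q A \<sigma> v \<noteq> {} \<longrightarrow> nucleus Q A \<tau> Right \<noteq> {} \<longrightarrow>
        nucleus Q A \<sigma> v <#>\<^bsub>Aus Q A\<^esub> nucleus Q A \<tau> Right = nucleus Q A (\<tau> \<circ> \<sigma>) Right \<and>
        nucleus_component Q A \<sigma> (inv_into UNIV \<tau> 2) v <#>\<^bsub>perm_group Q\<^esub> nucleus_component Q A \<tau> 2 Right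
          = nucleus_component Q A (\<tau> \<circ> \<sigma>) 2 Right \<and>
        nucleus_component Q A \<sigma> (inv_into UNIV \<tau> 3) v <#>\<^bsub>perm_group Q\<^esub> nucleus_component Q A \<tau> 3 Right
          = nucleus_component Q A (\<tau> \<circ> \<sigma>) 3 Right) \<and>
    (let v = kind_at (inv_into UNIV \<tau> 3) in
      nucleus Q A \<sigma> v \<noteq> {} \<longrightarrow> nucleus Q A \<tau> Middle \<noteq> {} \<longrightarrow>
        nucleus Q A \<sigma> v <#>\<^bsub>Aus Q A\<^esub> nucleus Q A \<tau> Middle = nucleus Q A (\<tau> \<circ> \<sigma>) Middle \<and>
        nucleus_component Q A \<sigma> (inv_into UNIV \<tau> 1) v <#>\<^bsub>perm_group Q\<^esub> nucleus_component Q A \<tau> 1 Middle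
          = nucleus_component Q A (\<tau> \<circ> \<sigma>) 1 Middle \<and>
        nucleus_component Q A \<sigma> (inv_into UNIV \<tau> 2) v <#>\<^bsub>perm_group Q\<^esub> nucleus_component Q A \<tau> 2 Middle
          = nucleus_component Q A (\<tau> \<circ> \<sigma>) 2 Middle)"
proof -
  interpret quasigroup Q A by fact
  have kinds: "Left = kind_at 2" "Right = kind_at 1" "Middle = kind_at 3"
    by (simp_all add: kind_at_def)
  show ?thesis
    unfolding Let_def kinds
    by (intro conjI impI nucleus_mult nucleus_component_mult assms) simp_all
qed

end
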